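(* Let $n\ge 2$ be an integer, and let $\tau>n-1$ and $\gamma\in(0,1)$ be real numbers such that $\mathcal{D}^1_n(\tau,\gamma)$ is nonempty. Let $\delta\in(0,\frac12)$ and set $N^*=(1+n^2\,n!)/\delta$. Then for every direction vector $\alpha\in\mathcal{D}^1_n(\tau,\gamma,N^* )$, the flow $\alpha_t$ fills $\mathbb{T}^n$ to within $\delta$ after some time $T$ satisfying $$T<\frac{C(n,\tau)}{\gamma\,\delta^{\tau}},\qquad\text{where } C(n,\tau)=(1+n^2\,n!)^{\tau+1}.$$
   Context: $\|\cdot\|$ denotes the Euclidean norm on $\mathbb{R}^n$ (and on $\mathbb{Z}^n\subset\mathbb{R}^n$), $k\cdot\alpha$ the Euclidean inner product, and $\mathbb{S}^{n-1}=\{\alpha\in\mathbb{R}^n : \|\alpha\|=1\}$. $\mathbb{T}^n=\mathbb{R}^n/\mathbb{Z}^n$ is the flat $n$-torus, with the distance induced by the Euclidean norm. Linear flow: for $\alpha\in\mathbb{S}^{n-1}$ and $t\in\mathbb{R}$, $\alpha_t:\mathbb{T}^n\to\mathbb{T}^n$ is defined by $\alpha_t(\theta)=\theta+t\alpha$ (mod $\mathbb{Z}^n$). Filling: given $\delta\in(0,\frac12)$ and a time $T\ge 0$, $\alpha_t$ fills $\mathbb{T}^n$ to within $\delta$ after time $T$ if, for any starting point $\theta\in\mathbb{T}^n$, the orbit segment $\{\alpha_t(\theta): 0\le t\le T\}$ is a $\delta$-dense subset of $\mathbb{T}^n$, meaning that every closed ball of radius $\delta$ in $\mathbb{T}^n$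 contains a point of the orbit segment. Diophantine sets: for $n\ge2$, $\tau>n-1$, $\gamma>0$ and real $N\ge1$, $$\mathcal{D}_n(\tau,\gamma)=\{\alpha\in\mathbb{R}^n : |k\cdot\alpha|\ge\gamma\|k\|^{-\tau}\text{ for all }k\in\mathbb{Z}^n\setminus\{0\}\},$$ $$\mathcal{D}_n(\tau,\gamma,N)=\{\alpha\in\mathbb{R}^n : |k\cdot\alpha|\ge\gamma\|k\|^{-\tau}\text{ for all }k\in\mathbb{Z}^n\text{ with }0<\|k\|\le N\},$$ and $\mathcal{D}^1_n(\tau,\gamma)=\mathbb{S}^{n-1}\cap\mathcal{D}_n(\tau,\gamma)$, $\mathcal{D}^1_n(\tau,\gamma,N)=\mathbb{S}^{n-1}\cap\mathcal{D}_n(\tau,\gamma,N)$. Elements of the latter two sets are called direction vectors. *)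

theory Defs
  imports "HOL-Analysis.Analysis"
begin

definition int_lattice :: "(real ^ 'n::finite) set"
  where "int_lattice = {k. \<forall>i. k $ i \<in> \<int>}"

lemma int_lattice_zero: "0 \<in> int_lattice"
  by (simp add: int_lattice_def)

lemma int_lattice_add: "a \<in> int_lattice \<Longrightarrow> b \<in> int_lattice \<Longrightarrow> a + b \<in> int_lattice"
  by (simp add: int_lattice_def)

lemma int_lattice_diff: "a \<in> int_lattice \<Longrightarrow> b \<in> int_lattice \<Longrightarrow> a - b \<in> int_lattice"
  by (simp add: int_lattice_def)

lemma int_lattice_minus: "a \<in> int_lattice \<Longrightarrow> - a \<in> int_lattice"
  by (simp add: int_lattice_def)

lemma closed_int_lattice: "closed (int_lattice :: (real ^ 'n::finite) set)"
proof -
  have "closed {k :: real ^ 'n. k $ i \<in> \<int>}" for i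
    using closed_vimage[OF closed_Ints, of "\<lambda>k :: real ^ 'n. k $ i"]
    by (simp add: vimage_def continuous_on_component)
  moreover have "(int_lattice :: (real ^ 'n) set) = (\<Inter>i. {k. k $ i \<in> \<int>})"
    by (auto simp: int_lattice_def)
  ultimately show ?thesis
    by (metis (no_types, lifting) closed_INT)
qed

definition torus_rel :: "real ^ 'n::finite \<Rightarrow> real ^ 'n \<Rightarrow> bool"
  where "torus_rel x y \<longleftrightarrow> x - y \<in> int_lattice"

lemma equivp_torus_rel: "equivp torus_rel"
proof (rule equivpI)
  show "reflp torus_rel"
    by (simp add: reflp_def torus_rel_def int_lattice_zero)
  show "symp torus_rel"
    by (metis int_lattice_minus minus_diff_eq symp_def torus_rel_def)
  show "transp torus_rel"
    by (smt (verit, best) int_lattice_add diff_add_cancel add_diff_eq torus_rel_def transp_def)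
qed

quotient_type (overloaded) 'n torus = "real ^ 'n::finite" / torus_rel
  by (rule equivp_torus_rel)

lemma bdd_below_norms: "bdd_below ((\<lambda>k. norm (f k)) ` S)"
  by (rule bdd_belowI2[of _ 0]) simp

instantiation torus :: (finite) metric_space
begin

(* The quotient metric: the least Euclidean distance between representatives. *)
lift_definition dist_torus :: "'a torus \<Rightarrow> 'a torus \<Rightarrow> real"
  is "\<lambda>x y. INF k\<in>int_lattice. norm (x - y - k)"
proof -
  fix x x' y y' :: "real ^ 'a"
  assume "torus_rel x x'" "torus_rel y y'"
  then have u: "(x - x') - (y - y') \<in> int_lattice" (is "?u \<in> _")
    by (simp add: torus_rel_def int_lattice_diff)
  have "(\<lambda>k. norm (x - y - k)) ` int_lattice = (\<lambda>k. norm (x' - y' - k)) ` int_lattice"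
  proof (intro equalityI image_subsetI)
    fix k :: "real ^ 'a" assume k: "k \<in> int_lattice"
    have "norm (x - y - k) = norm (x' - y' - (k - ?u))"
      by (simp add: algebra_simps)
    then show "norm (x - y - k) \<in> (\<lambda>k. norm (x' - y' - k)) ` int_lattice"
      using int_lattice_diff[OF k u] by blast
    have "norm (x' - y' - k) = norm (x - y - (k + ?u))"
      by (simp add: algebra_simps)
    then show "norm (x' - y' - k) \<in> (\<lambda>k. norm (x - y - k)) ` int_lattice"
      using int_lattice_add[OF k u] by blast
  qed
  then show "(INF k\<in>int_lattice. norm (x - y - k)) = (INF k\<in>int_lattice. norm (x' - y' - k))"
    by simp
qed

definition uniformity_torus :: "('a torus \<times> 'a torus) filter"
  where "uniformity_torus = (INF e\<in>{0<..}. principal {(x, y). dist x y < e})"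

definition open_torus :: "'a torus set \<Rightarrow> bool"
  where "open_torus U \<longleftrightarrow> (\<forall>x\<in>U. \<forall>\<^sub>F (x', y) in uniformity. x' = x \<longrightarrow> y \<in> U)"

instance
proof
  show "uniformity = (INF e\<in>{0<..}. principal {(x, y :: 'a torus). dist x y < e})"
    by (rule uniformity_torus_def)
  show "open U \<longleftrightarrow> (\<forall>x\<in>U. \<forall>\<^sub>F (x', y) in uniformity. x' = x \<longrightarrow> y \<in> U)" for U :: "'a torus set"
    by (rule open_torus_def)
  show "dist x y = 0 \<longleftrightarrow> x = y" for x y :: "'a torus"
  proof (transfer)
    fix x y :: "real ^ 'a"
    have ne: "(int_lattice :: (real ^ 'a) set) \<noteq> {}"
      using int_lattice_zero by blast
    have "(INF k\<in>int_lattice. norm (x - y - k)) = infdist (x - y) int_lattice"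
      using ne by (simp add: infdist_def dist_norm)
    then show "(INF k\<in>int_lattice. norm (x - y - k)) = 0 \<longleftrightarrow> torus_rel x y"
      using in_closed_iff_infdist_zero[OF closed_int_lattice ne, of "x - y"]
      by (simp add: torus_rel_def)
  qed
  show "dist x y \<le> dist x z + dist y z" for x y z :: "'a torus"
  proof (transfer)
    fix x y z :: "real ^ 'a"
    let ?L = "int_lattice :: (real ^ 'a) set"
    have ne: "?L \<noteq> {}"
      using int_lattice_zero by blast
    let ?d = "INF k\<in>?L. norm (x - y - k)"
    have *: "?d \<le> norm (x - z - k) + norm (y - z - l)" if "k \<in> ?L" "l \<in> ?L" for k l
    proof -
      have "?d \<le> norm (x - y - (k - l))"
        using that by (intro cINF_lower bdd_below_norms int_lattice_diff)
      also have "x - y - (k - l) = (x - z - k) - (y - z - l)"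
        by simp
      finally show ?thesis
        using norm_triangle_ineq4 order_trans by blast
    qed
    have "?d - norm (y - z - l) \<le> (INF k\<in>?L. norm (x - z - k))" if "l \<in> ?L" for l
      using *[OF _ that] by (intro cINF_greatest ne) (simp add: algebra_simps)
    then have "?d - (INF k\<in>?L. norm (x - z - k)) \<le> (INF l\<in>?L. norm (y - z - l))"
      by (intro cINF_greatest ne) (simp add: algebra_simps)
    then show "?d \<le> (INF k\<in>?L. norm (x - z - k)) + (INF k\<in>?L. norm (y - z - k))"
      by simp
  qed
qed

end

lift_definition linear_flow :: "real ^ 'n::finite \<Rightarrow> real \<Rightarrow> 'n torus \<Rightarrow> 'n torus"
  is "\<lambda>\<alpha> t \<theta>. \<theta> + t *\<^sub>R \<alpha>"
  by (simp add: torus_rel_def)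

definition delta_dense :: "real \<Rightarrow> 'a::metric_space set \<Rightarrow> bool"
  where "delta_dense \<delta> S \<longleftrightarrow> (\<forall>c. cball c \<delta> \<inter> S \<noteq> {})"

definition fills_torus :: "real ^ 'n::finite \<Rightarrow> real \<Rightarrow> real \<Rightarrow> bool"
  where "fills_torus \<alpha> \<delta> T \<longleftrightarrow>
    (\<forall>\<theta> :: 'n torus. delta_dense \<delta> ((\<lambda>t. linear_flow \<alpha> t \<theta>) ` {0..T}))"

definition diophantine :: "real \<Rightarrow> real \<Rightarrow> (real ^ 'n::finite) set"
  where "diophantine \<tau> \<gamma> =
    {\<alpha>. \<forall>k\<in>int_lattice - {0}. \<bar>k \<bullet> \<alpha>\<bar> \<ge> \<gamma> * norm k powr (- \<tau>)}"

definition diophantine_upto :: "real \<Rightarrow> real \<Rightarrow> real \<Rightarrow> (real ^ 'n::finite) set"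
  where "diophantine_upto \<tau> \<gamma> N =
    {\<alpha>. \<forall>k\<in>int_lattice. 0 < norm k \<and> norm k \<le> N \<longrightarrow> \<bar>k \<bullet> \<alpha>\<bar> \<ge> \<gamma> * norm k powr (- \<tau>)}"

definition diophantine_dir :: "real \<Rightarrow> real \<Rightarrow> (real ^ 'n::finite) set"
  where "diophantine_dir \<tau> \<gamma> = sphere 0 1 \<inter> diophantine \<tau> \<gamma>"

definition diophantine_dir_upto :: "real \<Rightarrow> real \<Rightarrow> real \<Rightarrow> (real ^ 'n::finite) set"
  where "diophantine_dir_upto \<tau> \<gamma> N = sphere 0 1 \<inter> diophantine_upto \<tau> \<gamma> N"

definition fill_const :: "nat \<Rightarrow> real \<Rightarrow> real"
  where "fill_const n \<tau> = (1 + real n ^ 2 * fact n) powr (\<tau> + 1)"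

end

theory Submission
  imports Defs
begin

text \<open>
  The Diophantine condition up to \<open>N\<close> gives a spectral gap \<open>\<bar>k \<bullet> \<alpha>\<bar> \<ge> \<epsilon> = \<gamma> N\<^sup>-\<^sup>\<tau>\<close> for
  \<open>0 < \<parallel>k\<parallel> \<le> N\<close>, and the gap alone bounds the filling time by \<open>8 / \<epsilon>\<close>. To see this, approximate
  \<open>\<alpha>\<close> by a rational direction \<open>p / P\<close> with period \<open>P\<close>, write \<open>y(u) = x + u p\<close> for the orbit and
  \<open>u \<in> [0, 1]\<close> for the rescaled time, and average
  \<open>(1 - sin\<^sup>2(\<pi> u) / \<rho> - \<Sum>\<^sub>i sin\<^sup>2(\<pi> y\<^sub>i(u)) / \<sigma>) g(u) \<Prod>\<^sub>i f(y\<^sub>i(u))\<close>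
  over \<open>u\<close>, where \<open>f, g \<ge> 0\<close> are trigonometric polynomials concentrated near the integers. Because
  of the gap no nonconstant frequencies cancel, so the average is computed from the constant
  coefficients alone, and it is positive. Hence the bracket is positive for some \<open>u\<close>: the orbit is
  close to the lattice at a time close to a multiple of the period.
\<close>

section \<open>Trigonometric polynomials and their constant coefficients\<close>

definition trig_poly :: "nat \<Rightarrow> (int \<Rightarrow> complex) \<Rightarrow> real \<Rightarrow> complex"
  where "trig_poly m d u = (\<Sum>r\<in>{- int m..int m}. d r * cis (2 * pi * (real_of_int r * u)))"

text \<open>The mean over a period, recorded algebraically as the constant coefficient of an
  expansion of degree at most \<open>m\<close>; averages are later taken over equally spaced points
  instead of by integration.\<close>

definition trig_mean :: "nat \<Rightarrow> complex \<Rightarrow> (real \<Rightarrow> complex) \<Rightarrow> bool"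
  where "trig_mean m \<mu> f \<longleftrightarrow> (\<exists>d. d 0 = \<mu> \<and> (\<forall>u. f u = trig_poly m d u))"

lemma trig_mean_add:
  assumes "trig_mean m \<mu> f" "trig_mean m \<nu> g"
  shows "trig_mean m (\<mu> + \<nu>) (\<lambda>u. f u + g u)"
proof -
  obtain d e where "d 0 = \<mu>" "\<And>u. f u = trig_poly m d u" "e 0 = \<nu>" "\<And>u. g u = trig_poly m e u"
    using assms by (auto simp: trig_mean_def)
  then show ?thesis
    unfolding trig_mean_def
    by (intro exI[of _ "\<lambda>r. d r + e r"]) (simp add: trig_poly_def sum.distrib distrib_right)
qed

lemma trig_mean_scale:
  assumes "trig_mean m \<mu> f"
  shows "trig_mean m (c * \<mu>) (\<lambda>u. c * f u)"
proof -
  obtain d where "d 0 = \<mu>" "\<And>u. f u = trig_poly m d u"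
    using assms by (auto simp: trig_mean_def)
  then show ?thesis
    unfolding trig_mean_def
    by (intro exI[of _ "\<lambda>r. c * d r"]) (simp add: trig_poly_def sum_distrib_left mult.assoc)
qed

lemma of_real_of_bool: "of_real (of_bool P) = (of_bool P :: complex)"
  by simp

lemma trig_mean_sum:
  assumes "finite A" "\<And>a. a \<in> A \<Longrightarrow> trig_mean m (\<mu> a) (f a)"
  shows "trig_mean m (\<Sum>a\<in>A. \<mu> a) (\<lambda>u. \<Sum>a\<in>A. f a u)"
  using assms
proof (induction A rule: finite_induct)
  case empty
  show ?case
    unfolding trig_mean_def by (intro exI[of _ "\<lambda>_. 0"]) (simp add: trig_poly_def)
next
  case (insert a A)
  then show ?case by (simp add: trig_mean_add)
qed

lemma trig_mean_cis:
  assumes "\<bar>r\<bar> \<le> int m"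
  shows "trig_mean m (of_bool (r = 0)) (\<lambda>u. cis (2 * pi * (real_of_int r * u)))"
  unfolding trig_mean_def
proof (intro exI conjI allI)
  show "cis (2 * pi * (real_of_int r * u)) = trig_poly m (\<lambda>s. of_bool (r = s)) u" for u
  proof -
    have "trig_poly m (\<lambda>s. of_bool (r = s)) u =
        (\<Sum>s\<in>{- int m..int m}. if r = s then cis (2 * pi * (real_of_int s * u)) else 0)"
      unfolding trig_poly_def by (intro sum.cong) auto
    also have "\<dots> = cis (2 * pi * (real_of_int r * u))"
      using assms by (subst sum.delta') (auto simp: abs_le_iff)
    finally show ?thesis by simp
  qed
qed simp

section \<open>Sampling at equally spaced points\<close>

text \<open>The terms are powers of a \<open>Q\<close>-th root of unity \<open>z\<close>; since
  \<open>Q\<close> does not divide \<open>q\<close>, \<open>z\<close> is not 1 and the geometric sum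
  vanishes. For \<open>Q = 0\<close> the sum is empty.\<close>

lemma sum_roots_of_unity:
  fixes q :: int
  assumes "\<not> int Q dvd q"
  shows "(\<Sum>j<Q. cis (2 * pi * (real_of_int q * (real j / real Q)))) = 0"
proof (cases "Q = 0")
  case False
  define z where "z = cis (2 * pi * real_of_int q / real Q)"
  have "z \<noteq> 1"
  proof
    assume "z = 1"
    then have "cos (2 * pi * real_of_int q / real Q) = 1"
      by (simp add: z_def complex_eq_iff)
    then obtain n :: int where "2 * pi * real_of_int q / real Q = real_of_int n * 2 * pi"
      using cos_one_2pi_int by blast
    then have "real_of_int q = real_of_int (n * int Q)"
      using False by (simp add: field_simps)
    then have "q = n * int Q" by linarith
    then show False using assms by simp
  qed
  have "z ^ Q = cis (real Q * (2 * pi * real_of_int q / real Q))"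
    unfolding z_def by (rule Complex.DeMoivre)
  also have "\<dots> = 1"
    using False by (simp add: cis_multiple_2pi)
  finally have "z ^ Q = 1" .
  have "(\<Sum>j<Q. cis (2 * pi * (real_of_int q * (real j / real Q)))) = (\<Sum>j<Q. z ^ j)"
    by (intro sum.cong) (simp_all add: z_def Complex.DeMoivre mult_ac)
  also have "\<dots> = 0"
    using \<open>z \<noteq> 1\<close> \<open>z ^ Q = 1\<close> by (simp add: sum_gp_strict)
  finally show ?thesis .
qed simp

text \<open>The only resonance between the frequencies is the trivial one, so sampling along a rational
  line returns the product of the means.\<close>

lemma sample_trig_mean:
  fixes p :: "'n::finite \<Rightarrow> int" and x :: "'n \<Rightarrow> real"
  assumes nonres: "\<And>(k :: 'n \<Rightarrow> int) l. (\<forall>i. \<bar>k i\<bar> \<le> int m) \<Longrightarrow> \<bar>l\<bar> \<le> int L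
      \<Longrightarrow> int Q dvd l + (\<Sum>i\<in>UNIV. k i * p i) \<Longrightarrow> l = 0 \<and> (\<forall>i. k i = 0)"
    and g: "trig_mean L \<mu> g" and f: "\<And>i. trig_mean m (\<nu> i) (f i)"
  shows "(\<Sum>j<Q. g (real j / real Q) * (\<Prod>i\<in>UNIV. f i (x i + real j / real Q * real_of_int (p i))))
    = of_nat Q * (\<mu> * (\<Prod>i\<in>UNIV. \<nu> i))"
proof -
  obtain d where d: "d 0 = \<mu>" "\<And>u. g u = trig_poly L d u"
    using g by (auto simp: trig_mean_def)
  have "\<forall>i. \<exists>h. h 0 = \<nu> i \<and> (\<forall>u. f i u = trig_poly m h u)"
    using f by (auto simp: trig_mean_def)
  then obtain h where h: "\<And>i. h i 0 = \<nu> i" "\<And>i u. f i u = trig_poly m (h i) u"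
    by metis
  let ?I = "{- int L..int L}"
  let ?K = "PiE (UNIV :: 'n set) (\<lambda>_. {- int m..int m})"
  have finK: "finite ?K" by (simp add: finite_PiE)
  \<comment> \<open>Expanding the product gives one exponential per pair \<open>(l, k)\<close>:
    \<open>q l k\<close> is its frequency in \<open>u\<close>, and \<open>c l k\<close> its
    coefficient, which absorbs the phases of the base point \<open>x\<close>.\<close>
  define c where "c l k = d l * (\<Prod>i\<in>UNIV. h i (k i) * cis (2 * pi * (real_of_int (k i) * x i)))"
    for l :: int and k :: "'n \<Rightarrow> int"
  define q where "q l k = l + (\<Sum>i\<in>UNIV. k i * p i)" for l :: int and k :: "'n \<Rightarrow> int"
  have prodcis: "(\<Prod>i\<in>A. cis (y i)) = cis (\<Sum>i\<in>A. y i)" if "finite A" for A :: "'n set" and y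
    using that by (induction A rule: finite_induct) (simp_all add: cis_mult)
  have expand: "g u * (\<Prod>i\<in>UNIV. f i (x i + u * real_of_int (p i))) =
      (\<Sum>l\<in>?I. \<Sum>k\<in>?K. c l k * cis (2 * pi * (real_of_int (q l k) * u)))" for u
  proof -
    have "(\<Prod>i\<in>UNIV. f i (x i + u * real_of_int (p i))) =
        (\<Sum>k\<in>?K. \<Prod>i\<in>UNIV. h i (k i) * cis (2 * pi * (real_of_int (k i) * (x i + u * real_of_int (p i)))))"
      unfolding h(2) trig_poly_def by (subst prod_sum_PiE) auto
    moreover have "(\<Prod>i\<in>UNIV. h i (k i) * cis (2 * pi * (real_of_int (k i) * (x i + u * real_of_int (p i)))))
        = (\<Prod>i\<in>UNIV. h i (k i) * cis (2 * pi * (real_of_int (k i) * x i)))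
          * cis (2 * pi * (real_of_int (\<Sum>i\<in>UNIV. k i * p i) * u))" for k
    proof -
      have "cis (2 * pi * (real_of_int (\<Sum>i\<in>UNIV. k i * p i) * u)) =
          (\<Prod>i\<in>UNIV. cis (2 * pi * (real_of_int (k i * p i) * u)))"
        by (simp add: prodcis sum_distrib_left sum_distrib_right mult_ac)
      then show ?thesis
        by (simp add: prod.distrib [symmetric] cis_mult algebra_simps)
    qed
    ultimately have *: "(\<Prod>i\<in>UNIV. f i (x i + u * real_of_int (p i))) =
        (\<Sum>k\<in>?K. (\<Prod>i\<in>UNIV. h i (k i) * cis (2 * pi * (real_of_int (k i) * x i)))
          * cis (2 * pi * (real_of_int (\<Sum>i\<in>UNIV. k i * p i) * u)))"
      by simp
    have term_eq: "d l * cis (2 * pi * (real_of_int l * u)) *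
        ((\<Prod>i\<in>UNIV. h i (k i) * cis (2 * pi * (real_of_int (k i) * x i)))
          * cis (2 * pi * (real_of_int (\<Sum>i\<in>UNIV. k i * p i) * u)))
        = c l k * cis (2 * pi * (real_of_int (q l k) * u))" for l k
    proof -
      have "cis (2 * pi * (real_of_int (q l k) * u)) = cis (2 * pi * (real_of_int l * u)) *
          cis (2 * pi * (real_of_int (\<Sum>i\<in>UNIV. k i * p i) * u))"
        unfolding cis_mult q_def of_int_add by (simp only: distrib_left distrib_right)
      then show ?thesis
        by (simp only: c_def mult_ac)
    qed
    show ?thesis
      unfolding * d(2) trig_poly_def sum_product term_eq ..
  qed
  \<comment> \<open>Summing over the sample points kills every frequency not divisible by
    \<open>Q\<close>, and \<open>nonres\<close> leaves only the constant term.\<close>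
  have zero: "(\<Sum>j<Q. cis (2 * pi * (real_of_int (q l k) * (real j / real Q)))) =
      (if l = 0 \<and> k = (\<lambda>_. 0) then of_nat Q else 0)" if "l \<in> ?I" "k \<in> ?K" for l k
  proof (cases "l = 0 \<and> k = (\<lambda>_. 0)")
    case True
    then show ?thesis by (simp add: q_def)
  next
    case False
    have k: "\<forall>i. \<bar>k i\<bar> \<le> int m"
      using that(2) by (auto simp: PiE_iff abs_le_iff minus_le_iff)
    have l: "\<bar>l\<bar> \<le> int L" using that(1) by auto
    have "\<not> int Q dvd q l k"
      using nonres[OF k l] False unfolding q_def by blast
    from sum_roots_of_unity[OF this] show ?thesis
      unfolding if_not_P[OF False] .
  qed
  have "(\<Sum>j<Q. g (real j / real Q) * (\<Prod>i\<in>UNIV. f i (x i + real j / real Q * real_of_int (p i))))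
      = (\<Sum>j<Q. \<Sum>l\<in>?I. \<Sum>k\<in>?K. c l k * cis (2 * pi * (real_of_int (q l k) * (real j / real Q))))"
    unfolding expand ..
  also have "\<dots> = (\<Sum>l\<in>?I. \<Sum>k\<in>?K. \<Sum>j<Q. c l k * cis (2 * pi * (real_of_int (q l k) * (real j / real Q))))"
    by (subst sum.swap) (intro sum.cong refl sum.swap)
  also have "\<dots> = (\<Sum>l\<in>?I. \<Sum>k\<in>?K. c l k * (\<Sum>j<Q. cis (2 * pi * (real_of_int (q l k) * (real j / real Q)))))"
    by (simp only: sum_distrib_left)
  also have "\<dots> = (\<Sum>l\<in>?I. \<Sum>k\<in>?K. c l k * (if l = 0 \<and> k = (\<lambda>_. 0) then of_nat Q else 0))"
    by (intro sum.cong refl) (simp only: zero)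
  also have "\<dots> = (\<Sum>l\<in>?I. if l = 0 then c l (\<lambda>_. 0) * of_nat Q else 0)"
  proof (intro sum.cong refl)
    fix l
    have "(\<Sum>k\<in>?K. c l k * (if l = 0 \<and> k = (\<lambda>_. 0) then of_nat Q else 0)) =
        (\<Sum>k\<in>?K. if k = (\<lambda>_. 0) then (if l = 0 then c l k * of_nat Q else 0) else 0)"
      by (intro sum.cong) auto
    then show "(\<Sum>k\<in>?K. c l k * (if l = 0 \<and> k = (\<lambda>_. 0) then of_nat Q else 0)) =
        (if l = 0 then c l (\<lambda>_. 0) * of_nat Q else 0)"
      using finK by (simp add: PiE_iff)
  qed
  also have "\<dots> = of_nat Q * (\<mu> * (\<Prod>i\<in>UNIV. \<nu> i))"
    by (simp add: c_def d h)
  finally show ?thesis .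
qed

section \<open>A nonnegative kernel concentrated near the integers\<close>

text \<open>Fejer's extremal kernel: the coefficients \<open>sin (a \<phi>)\<close> satisfy a three-term recurrence, which
  makes the mean of \<open>sin\<^sup>2 (\<pi> u)\<close> against the kernel quadratically small in the degree.\<close>

lemma concentrated_kernel:
  assumes "1 \<le> m"
  obtains w :: "real \<Rightarrow> real" and b :: real
  where "\<And>u. 0 \<le> w u" "trig_mean m 1 (\<lambda>u. of_real (w u))"
    "trig_mean m (of_real b) (\<lambda>u. of_real (w u * (sin (pi * u))\<^sup>2))"
    "b \<le> (pi / (2 * real (m + 1)))\<^sup>2"
proof -
  \<comment> \<open>This angle makes \<open>c\<close> vanish at 0 and \<open>m + 1\<close>, just
    outside the index range, so on that range \<open>c\<close> is an exact eigenvector of the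
    tridiagonal form met below.\<close>
  define \<phi> where "\<phi> = pi / real (m + 1)"
  define c where "c a = sin (real_of_int a * \<phi>)" for a :: int
  let ?A = "{1..int m}"
  define S where "S = (\<Sum>a\<in>?A. (c a)\<^sup>2)"
  have c_end: "c 0 = 0" "c (int m + 1) = 0"
  proof -
    have "real_of_int (int m + 1) * \<phi> = pi"
      by (simp add: \<phi>_def add.commute)
    then show "c (int m + 1) = 0"
      by (simp add: c_def del: of_int_add)
  qed (simp add: c_def)
  have rec: "c (a - 1) + c (a + 1) = 2 * cos \<phi> * c a" for a
    by (simp add: c_def sin_add sin_diff algebra_simps)
  have "c 1 > 0"
    using assms unfolding c_def \<phi>_def by (intro sin_gt_zero) (auto simp: field_simps)
  moreover have "(c 1)\<^sup>2 \<le> S"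
    unfolding S_def using assms by (intro member_le_sum) auto
  ultimately have S: "S > 0"
    by (smt (verit) zero_less_power)
  define v where "v u = (\<Sum>a\<in>?A. of_real (c a) * cis (2 * pi * (real_of_int a * u)))" for u
  \<comment> \<open>A squared modulus is nonnegative, and division by its constant coefficient
    \<open>S\<close> normalises the mean to 1. Frequencies in \<open>v\<close> differ by at most
    \<open>m - 1\<close>, leaving room for the degree 1 of the squared sine.\<close>
  define w where "w u = (norm (v u))\<^sup>2 / S" for u
  have vv: "of_real ((norm (v u))\<^sup>2) =
      (\<Sum>a\<in>?A. \<Sum>b\<in>?A. of_real (c a * c b) * cis (2 * pi * (real_of_int (a - b) * u)))" for u
  proof -
    have "of_real ((norm (v u))\<^sup>2) = v u * cnj (v u)"
      by (rule complex_norm_square)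
    also have "\<dots> = (\<Sum>a\<in>?A. \<Sum>b\<in>?A. (of_real (c a) * cis (2 * pi * (real_of_int a * u))) *
        (of_real (c b) * cis (- (2 * pi * (real_of_int b * u)))))"
      by (simp add: v_def sum_product cis_cnj)
    also have "\<dots> = (\<Sum>a\<in>?A. \<Sum>b\<in>?A. of_real (c a * c b) * cis (2 * pi * (real_of_int (a - b) * u)))"
    proof (intro sum.cong refl)
      fix a b :: int
      have "cis (2 * pi * (real_of_int (a - b) * u)) =
          cis (2 * pi * (real_of_int a * u)) * cis (- (2 * pi * (real_of_int b * u)))"
        by (simp add: cis_mult algebra_simps)
      then show "(of_real (c a) * cis (2 * pi * (real_of_int a * u))) *
        (of_real (c b) * cis (- (2 * pi * (real_of_int b * u)))) =
        of_real (c a * c b) * cis (2 * pi * (real_of_int (a - b) * u))"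
        by (simp add: mult_ac)
    qed
    finally show ?thesis .
  qed
  have sin_sq: "of_real ((sin (pi * u))\<^sup>2) =
      1 / 2 - cis (2 * pi * u) / 4 - cis (- (2 * pi * u)) / 4" for u
  proof -
    have "cos (2 * pi * u) = 1 - 2 * (sin (pi * u))\<^sup>2"
      using cos_double_sin[of "pi * u"] by (simp add: mult.assoc)
    then show ?thesis
      by (simp add: complex_eq_iff diff_divide_distrib)
  qed
  have vvs: "of_real ((norm (v u))\<^sup>2 * (sin (pi * u))\<^sup>2) =
      (\<Sum>a\<in>?A. \<Sum>b\<in>?A. of_real (c a * c b) *
        (1 / 2 * cis (2 * pi * (real_of_int (a - b) * u))
          + ((- 1 / 4) * cis (2 * pi * (real_of_int (a - b + 1) * u))
          + (- 1 / 4) * cis (2 * pi * (real_of_int (a - b - 1) * u)))))" for u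
  proof -
    have "cis (2 * pi * (real_of_int r * u)) * (1 / 2 - cis (2 * pi * u) / 4 - cis (- (2 * pi * u)) / 4) =
        (1 / 2 * cis (2 * pi * (real_of_int r * u))
          + ((- 1 / 4) * cis (2 * pi * (real_of_int (r + 1) * u))
          + (- 1 / 4) * cis (2 * pi * (real_of_int (r - 1) * u))))" for r
    proof -
      have "cis (2 * pi * (real_of_int (r + 1) * u)) = cis (2 * pi * (real_of_int r * u)) * cis (2 * pi * u)"
        "cis (2 * pi * (real_of_int (r - 1) * u)) = cis (2 * pi * (real_of_int r * u)) * cis (- (2 * pi * u))"
        by (simp_all add: cis_mult algebra_simps)
      then show ?thesis by (simp add: algebra_simps)
    qed
    then show ?thesis
      unfolding of_real_mult[of "(norm (v u))\<^sup>2"] vv sin_sq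
      by (simp only: sum_distrib_right mult.assoc)
  qed
  have deg: "\<bar>a - b\<bar> \<le> int m" "\<bar>a - b + 1\<bar> \<le> int m" "\<bar>a - b - 1\<bar> \<le> int m"
    if "a \<in> ?A" "b \<in> ?A" for a b
    using that by auto
  have "trig_mean m (\<Sum>a\<in>?A. \<Sum>b\<in>?A. of_real (c a * c b) * of_bool (a - b = 0)) (\<lambda>u. of_real ((norm (v u))\<^sup>2))"
    unfolding vv using deg
    by (intro trig_mean_sum trig_mean_scale trig_mean_cis) auto
  moreover have "(\<Sum>a\<in>?A. \<Sum>b\<in>?A. of_real (c a * c b) * of_bool (a - b = 0)) = complex_of_real S"
  proof -
    have "(\<Sum>b\<in>?A. complex_of_real (c a * c b) * of_bool (a - b = 0)) = of_real ((c a)\<^sup>2)"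
      if "a \<in> ?A" for a
    proof -
      have "(\<Sum>b\<in>?A. complex_of_real (c a * c b) * of_bool (a - b = 0)) =
          (\<Sum>b\<in>?A. if a = b then of_real (c a * c b) else 0)"
        by (intro sum.cong) auto
      then show ?thesis
        using that by (simp add: power2_eq_square)
    qed
    then show ?thesis by (simp add: S_def)
  qed
  ultimately have mean: "trig_mean m (of_real S) (\<lambda>u. of_real ((norm (v u))\<^sup>2))"
    by simp
  have "trig_mean m (\<Sum>a\<in>?A. \<Sum>b\<in>?A. of_real (c a * c b) *
      (1 / 2 * of_bool (a - b = 0) + ((- 1 / 4) * of_bool (a - b + 1 = 0) + (- 1 / 4) * of_bool (a - b - 1 = 0))))
    (\<lambda>u. of_real ((norm (v u))\<^sup>2 * (sin (pi * u))\<^sup>2))"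
    unfolding vvs using deg
    by (intro trig_mean_sum trig_mean_scale trig_mean_add trig_mean_cis) auto
  moreover have "(\<Sum>a\<in>?A. \<Sum>b\<in>?A. of_real (c a * c b) *
      (1 / 2 * of_bool (a - b = 0) + ((- 1 / 4) * of_bool (a - b + 1 = 0) + (- 1 / 4) * of_bool (a - b - 1 = 0))))
      = complex_of_real (S * (sin (\<phi> / 2))\<^sup>2)"
  proof -
    \<comment> \<open>The constant coefficient is a quadratic form with 1/2 on the diagonal and -1/4
      beside it. Admitting \<open>b = 0\<close> and \<open>b = m + 1\<close>, where \<open>c\<close>
      is zero, gives every row both neighbours, and \<open>rec\<close> yields the eigenvalue
      \<open>(1 - cos \<phi>) / 2\<close>.\<close>
    have inner: "(\<Sum>b\<in>?A. c a * c b *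
        (1 / 2 * of_bool (a - b = 0) + ((- 1 / 4) * of_bool (a - b + 1 = 0) + (- 1 / 4) * of_bool (a - b - 1 = 0))))
        = (c a)\<^sup>2 * (sin (\<phi> / 2))\<^sup>2" if a: "a \<in> ?A" for a
    proof -
      have "(\<Sum>b\<in>?A. c a * c b *
        (1 / 2 * of_bool (a - b = 0) + ((- 1 / 4) * of_bool (a - b + 1 = 0) + (- 1 / 4) * of_bool (a - b - 1 = 0))))
        = (\<Sum>b\<in>{0..int m + 1}. c a * c b *
        (1 / 2 * of_bool (a - b = 0) + ((- 1 / 4) * of_bool (a - b + 1 = 0) + (- 1 / 4) * of_bool (a - b - 1 = 0))))"
      proof (rule sum.mono_neutral_left)
        have "b = 0 \<or> b = int m + 1" if "b \<in> {0..int m + 1} - ?A" for b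
          using that by auto
        then show "\<forall>b\<in>{0..int m + 1} - ?A. c a * c b *
          (1 / 2 * of_bool (a - b = 0) + ((- 1 / 4) * of_bool (a - b + 1 = 0) + (- 1 / 4) * of_bool (a - b - 1 = 0))) = 0"
          using c_end by fastforce
      qed auto
      also have "\<dots> = (\<Sum>b\<in>{0..int m + 1}. (if a = b then c a * c b / 2 else 0)
          + ((if a + 1 = b then - (c a * c b / 4) else 0) + (if a - 1 = b then - (c a * c b / 4) else 0)))"
        by (intro sum.cong) auto
      also have "\<dots> = c a * c a / 2 + (- (c a * c (a + 1) / 4) + - (c a * c (a - 1) / 4))"
        using a by (simp add: sum.distrib)
      also have "\<dots> = c a * (c a / 2 - (c (a - 1) + c (a + 1)) / 4)"
        by (simp add: field_simps)
      also have "\<dots> = (c a)\<^sup>2 * ((1 - cos \<phi>) / 2)"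
        unfolding rec by (simp add: power2_eq_square field_simps)
      also have "(1 - cos \<phi>) / 2 = (sin (\<phi> / 2))\<^sup>2"
        using cos_double_sin[of "\<phi> / 2"] by simp
      finally show ?thesis .
    qed
    have "(\<Sum>a\<in>?A. \<Sum>b\<in>?A. c a * c b *
        (1 / 2 * of_bool (a - b = 0) + ((- 1 / 4) * of_bool (a - b + 1 = 0) + (- 1 / 4) * of_bool (a - b - 1 = 0))))
        = S * (sin (\<phi> / 2))\<^sup>2"
      unfolding S_def sum_distrib_right by (intro sum.cong refl inner)
    from arg_cong[OF this, of complex_of_real] show ?thesis
      by (simp only: of_real_sum of_real_mult of_real_add of_real_divide of_real_minus of_real_1
          of_real_numeral of_real_of_bool)
  qed
  ultimately have mean': "trig_mean m (of_real (S * (sin (\<phi> / 2))\<^sup>2))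
      (\<lambda>u. of_real ((norm (v u))\<^sup>2 * (sin (pi * u))\<^sup>2))"
    by simp
  show thesis
  proof
    show "0 \<le> w u" for u
      using S by (simp add: w_def)
    show "trig_mean m 1 (\<lambda>u. of_real (w u))"
      using trig_mean_scale[OF mean, of "of_real (1 / S)"] S by (simp add: w_def)
    show "trig_mean m (of_real ((sin (\<phi> / 2))\<^sup>2)) (\<lambda>u. of_real (w u * (sin (pi * u))\<^sup>2))"
      using trig_mean_scale[OF mean', of "of_real (1 / S)"] S by (simp add: w_def)
    have "\<bar>sin (\<phi> / 2)\<bar> \<le> \<bar>\<phi> / 2\<bar>"
      by (rule abs_sin_x_le_abs_x)
    then have "(sin (\<phi> / 2))\<^sup>2 \<le> (\<phi> / 2)\<^sup>2"
      by (simp only: abs_le_square_iff)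
    then show "(sin (\<phi> / 2))\<^sup>2 \<le> (pi / (2 * real (m + 1)))\<^sup>2"
      by (simp add: \<phi>_def mult.commute)
  qed
qed

section \<open>Averaging along a rational line\<close>

text \<open>\<open>\<rho>\<close> and \<open>\<sigma>\<close> are squared tolerances in time and
  space. If the penalty \<open>D\<close> were at least 1 everywhere, so would be its kernel-weighted
  average; but concentration of the kernels bounds that average by the left side of
  \<open>small\<close>.\<close>

lemma rational_line_meets_origin:
  fixes p :: "'n::finite \<Rightarrow> int" and x :: "'n \<Rightarrow> real"
  assumes "1 \<le> L" "1 \<le> m" "0 < \<rho>" "0 < \<sigma>"
    and nonres: "\<And>k :: 'n \<Rightarrow> int. k \<noteq> (\<lambda>_. 0) \<Longrightarrow> (\<forall>i. \<bar>k i\<bar> \<le> int m) \<Longrightarrow> int L < \<bar>\<Sum>i\<in>UNIV. k i * p i\<bar>"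
    and small: "(pi / (2 * real (L + 1)))\<^sup>2 / \<rho>
      + real CARD('n) * (pi / (2 * real (m + 1)))\<^sup>2 / \<sigma> < 1"
  obtains u :: real
  where "(sin (pi * u))\<^sup>2 / \<rho> + (\<Sum>i\<in>UNIV. (sin (pi * (x i + u * real_of_int (p i))))\<^sup>2) / \<sigma> < 1"
proof (rule ccontr)
  define D where "D u = (sin (pi * u))\<^sup>2 / \<rho>
      + (\<Sum>i\<in>UNIV. (sin (pi * (x i + u * real_of_int (p i))))\<^sup>2) / \<sigma>" for u
  assume "\<not> thesis"
  then have far: "1 \<le> D u" for u
    using that unfolding D_def by (meson not_le)
  obtain g b where g: "\<And>u. 0 \<le> g u" "trig_mean L 1 (\<lambda>u. of_real (g u))"
    "trig_mean L (of_real b) (\<lambda>u. of_real (g u * (sin (pi * u))\<^sup>2))"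
    "b \<le> (pi / (2 * real (L + 1)))\<^sup>2"
    using concentrated_kernel[OF \<open>1 \<le> L\<close>] by blast
  obtain f c where f: "\<And>u. 0 \<le> f u" "trig_mean m 1 (\<lambda>u. of_real (f u))"
    "trig_mean m (of_real c) (\<lambda>u. of_real (f u * (sin (pi * u))\<^sup>2))"
    "c \<le> (pi / (2 * real (m + 1)))\<^sup>2"
    using concentrated_kernel[OF \<open>1 \<le> m\<close>] by blast
  \<comment> \<open>Larger than every frequency \<open>l + k . p\<close> in range, so divisibility
    by \<open>Q\<close> forces the frequency to be exactly zero; the gap \<open>L < |k . p|\<close>
    for nonzero \<open>k\<close> then leaves only \<open>k = 0\<close>.\<close>
  define Q where "Q = nat (int L + int m * (\<Sum>i\<in>UNIV. \<bar>p i\<bar>)) + 1"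
  have Q: "int Q = int L + int m * (\<Sum>i\<in>UNIV. \<bar>p i\<bar>) + 1"
    by (simp add: Q_def sum_nonneg)
  have nonres': "l = 0 \<and> (\<forall>i. k i = 0)"
    if k: "\<forall>i. \<bar>k i\<bar> \<le> int m" and l: "\<bar>l\<bar> \<le> int L" and dvd: "int Q dvd l + (\<Sum>i\<in>UNIV. k i * p i)"
    for k :: "'n \<Rightarrow> int" and l
  proof -
    have "\<bar>\<Sum>i\<in>UNIV. k i * p i\<bar> \<le> (\<Sum>i\<in>UNIV. int m * \<bar>p i\<bar>)"
      using k by (intro order_trans[OF sum_abs] sum_mono) (simp add: abs_mult mult_right_mono)
    then have "\<bar>l + (\<Sum>i\<in>UNIV. k i * p i)\<bar> < int Q"
      using l unfolding Q sum_distrib_left by linarith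
    then have *: "l + (\<Sum>i\<in>UNIV. k i * p i) = 0"
      using dvd_imp_le_int[OF _ dvd] by linarith
    have "k = (\<lambda>_. 0)"
    proof (rule ccontr)
      assume "k \<noteq> (\<lambda>_. 0)"
      from nonres[OF this k] show False
        using l * by linarith
    qed
    then show ?thesis using * by simp
  qed
  let ?t = "\<lambda>j. real j / real Q" and ?y = "\<lambda>j i. x i + real j / real Q * real_of_int (p i)"
  have sample: "(\<Sum>j<Q. G (?t j) * (\<Prod>i\<in>UNIV. F i (?y j i))) = real Q * (\<mu> * (\<Prod>i\<in>UNIV. \<nu> i))"
    if "trig_mean L (of_real \<mu>) (\<lambda>u. of_real (G u))"
      "\<And>i. trig_mean m (of_real (\<nu> i)) (\<lambda>u. of_real (F i u))"
    for \<mu> :: real and G \<nu> and F :: "'n \<Rightarrow> real \<Rightarrow> real"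
  proof -
    have "complex_of_real (\<Sum>j<Q. G (?t j) * (\<Prod>i\<in>UNIV. F i (?y j i)))
        = complex_of_real (real Q * (\<mu> * (\<Prod>i\<in>UNIV. \<nu> i)))"
      using sample_trig_mean[where p = p and x = x and Q = Q, OF nonres' that] by simp
    then show ?thesis by (simp only: of_real_eq_iff)
  qed
  define W where "W j = g (?t j) * (\<Prod>i\<in>UNIV. f (?y j i))" for j
  have W_nonneg: "0 \<le> W j" for j
    by (simp add: W_def g f prod_nonneg)
  have mean: "(\<Sum>j<Q. W j) = real Q"
    using sample[of 1 g "\<lambda>_. 1" "\<lambda>_. f"] g(2) f(2) by (simp add: W_def)
  have time: "(\<Sum>j<Q. W j * (sin (pi * ?t j))\<^sup>2) = real Q * b"
    using sample[of b "\<lambda>u. g u * (sin (pi * u))\<^sup>2" "\<lambda>_. 1" "\<lambda>_. f"] g(3) f(2)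
    by (simp add: W_def mult_ac)
  \<comment> \<open>The squared sine is attached to the kernel of coordinate \<open>i\<close> alone;
    all other factors keep mean 1.\<close>
  have space: "(\<Sum>j<Q. W j * (sin (pi * ?y j i))\<^sup>2) = real Q * c" for i
  proof -
    have "(\<Prod>i'\<in>UNIV. f (?y j i') * (if i' = i then (sin (pi * ?y j i'))\<^sup>2 else 1)) =
        (\<Prod>i'\<in>UNIV. f (?y j i')) * (sin (pi * ?y j i))\<^sup>2" for j
      by (simp add: prod.distrib)
    moreover have "trig_mean m (of_real (if i' = i then c else 1))
        (\<lambda>u. of_real (f u * (if i' = i then (sin (pi * u))\<^sup>2 else 1)))" for i'
      using f(2,3) by (cases "i' = i") simp_all
    ultimately show ?thesis
      using sample[of 1 g "\<lambda>i'. if i' = i then c else 1" "\<lambda>i' u. f u * (if i' = i then (sin (pi * u))\<^sup>2 else 1)"] g(2)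
      by (simp add: W_def mult.assoc)
  qed
  have "real Q = (\<Sum>j<Q. W j)"
    by (simp only: mean)
  also have "\<dots> \<le> (\<Sum>j<Q. W j * D (?t j))"
    using mult_left_mono[OF far W_nonneg] by (intro sum_mono) simp
  also have "\<dots> = (\<Sum>j<Q. W j * (sin (pi * ?t j))\<^sup>2) / \<rho>
      + (\<Sum>i\<in>UNIV. \<Sum>j<Q. W j * (sin (pi * ?y j i))\<^sup>2) / \<sigma>"
    unfolding D_def
    by (subst sum.swap)
      (simp add: distrib_left sum.distrib sum_divide_distrib sum_distrib_left)
  also have "\<dots> = real Q * (b / \<rho> + real CARD('n) * c / \<sigma>)"
    unfolding time space by (simp add: distrib_left)
  also have "\<dots> < real Q * 1"
  proof (rule mult_strict_left_mono)
    have "b / \<rho> + real CARD('n) * c / \<sigma> \<le> (pi / (2 * real (L + 1)))\<^sup>2 / \<rho>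
      + real CARD('n) * (pi / (2 * real (m + 1)))\<^sup>2 / \<sigma>"
      using g(4) f(4) \<open>0 < \<rho>\<close> \<open>0 < \<sigma>\<close>
      by (intro add_mono divide_right_mono mult_left_mono) auto
    then show "b / \<rho> + real CARD('n) * c / \<sigma> < 1"
      using small by linarith
    have "0 < Q"
      by (simp add: Q_def)
    then show "0 < real Q"
      by simp
  qed
  finally show False by simp
qed

section \<open>From the sine penalty to distances\<close>

text \<open>Jordan's inequality: sine is concave on \<open>[0, pi / 2]\<close>, hence lies above its
  chord.\<close>

lemma abs_le_abs_sin_pi:
  fixes v :: real
  assumes "\<bar>v\<bar> \<le> 1 / 2"
  shows "2 * \<bar>v\<bar> \<le> \<bar>sin (pi * v)\<bar>"
proof -
  have "convex_on {0..pi / 2} (\<lambda>x. - sin x)"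
    by (rule f''_ge0_imp_convex[where f' = "\<lambda>x. - cos x" and f'' = sin])
      (auto intro!: derivative_eq_intros sin_ge_zero)
  then have "- sin ((1 - 2 * \<bar>v\<bar>) *\<^sub>R 0 + (2 * \<bar>v\<bar>) *\<^sub>R (pi / 2))
      \<le> (1 - 2 * \<bar>v\<bar>) * - sin 0 + (2 * \<bar>v\<bar>) * - sin (pi / 2)"
    using assms by (intro convex_onD) auto
  then have "2 * \<bar>v\<bar> \<le> sin (pi * \<bar>v\<bar>)"
    by (simp add: mult.commute)
  then show ?thesis
    by (cases "v \<ge> 0") auto
qed

text \<open>Squaring makes \<open>sin (pi * v)\<close> 1-periodic, so Jordan's inequality applies to
  the offset from the nearest integer.\<close>

lemma sin_squared_bound:
  "4 * (v - of_int (round v))\<^sup>2 \<le> (sin (pi * v))\<^sup>2" for v :: real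
proof -
  let ?r = "v - of_int (round v)"
  have "\<bar>?r\<bar> \<le> 1 / 2"
    using of_int_round_abs_le[of v] by (simp add: abs_minus_commute)
  then have "2 * \<bar>?r\<bar> \<le> \<bar>sin (pi * ?r)\<bar>"
    by (rule abs_le_abs_sin_pi)
  then have "(2 * \<bar>?r\<bar>)\<^sup>2 \<le> \<bar>sin (pi * ?r)\<bar>\<^sup>2"
    by (intro power_mono) auto
  moreover have "(sin (pi * ?r))\<^sup>2 = (sin (pi * v))\<^sup>2"
    by (simp add: right_diff_distrib sin_diff power_mult_distrib sin_integer_2pi cos_npi_int
        flip: mult.commute[of pi])
  ultimately show ?thesis
    by (simp add: power_mult_distrib)
qed

section \<open>Filling in Euclidean terms, and rational directions\<close>

text \<open>The torus distance is an infimum over lattice translates, so a single translate bounds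
  it.\<close>

lemma fills_torusI:
  fixes \<alpha> :: "real ^ 'n::finite"
  assumes "\<And>\<theta> c :: real ^ 'n. \<exists>t\<in>{0..T}. \<exists>k\<in>int_lattice. norm (c - (\<theta> + t *\<^sub>R \<alpha>) - k) \<le> \<delta>"
  shows "fills_torus \<alpha> \<delta> T"
proof -
  have "\<exists>t\<in>{0..T}. dist c' (linear_flow \<alpha> t \<theta>') \<le> \<delta>" for \<theta>' c' :: "'n torus"
  proof (induct \<theta>' rule: torus.abs_induct, induct c' rule: torus.abs_induct)
    fix \<theta> c :: "real ^ 'n"
    obtain t k where t: "t \<in> {0..T}" and k: "k \<in> int_lattice"
      and le: "norm (c - (\<theta> + t *\<^sub>R \<alpha>) - k) \<le> \<delta>"
      using assms by blast
    have "dist (abs_torus c) (linear_flow \<alpha> t (abs_torus \<theta>)) =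
        (INF k\<in>int_lattice. norm (c - (\<theta> + t *\<^sub>R \<alpha>) - k))"
      by (simp only: linear_flow.abs_eq dist_torus.abs_eq)
    also have "\<dots> \<le> norm (c - (\<theta> + t *\<^sub>R \<alpha>) - k)"
      by (rule cINF_lower[OF bdd_below_norms k])
    also note le
    finally show "\<exists>t\<in>{0..T}. dist (abs_torus c) (linear_flow \<alpha> t (abs_torus \<theta>)) \<le> \<delta>"
      using t by (rule bexI)
  qed
  then show ?thesis
    by (simp add: fills_torus_def delta_dense_def disjoint_iff mem_cball) blast
qed

text \<open>Rounding \<open>P * \<alpha> $ i\<close> down costs at most \<open>1 / P\<close> per
  coordinate, hence \<open>CARD('n) / P\<close> in the l1 norm, which dominates the Euclidean one.
  Every large \<open>P\<close> works, so a lower bound \<open>K\<close> can be imposed as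
  well.\<close>

lemma approx_by_fractions:
  fixes \<alpha> :: "real ^ 'n::finite"
  assumes "0 < \<eta>"
  obtains P :: real and p :: "'n \<Rightarrow> int"
  where "K \<le> P" "0 < P" "norm (\<alpha> - (\<chi> i. real_of_int (p i) / P)) \<le> \<eta>"
proof
  define P where "P = max (max K 1) (real CARD('n) / \<eta>)"
  define p where "p i = \<lfloor>P * \<alpha> $ i\<rfloor>" for i
  show "K \<le> P" and P: "0 < P"
    by (auto simp: P_def)
  have "norm (\<alpha> - (\<chi> i. real_of_int (p i) / P)) \<le> (\<Sum>i\<in>UNIV. \<bar>\<alpha> $ i - real_of_int (p i) / P\<bar>)"
    using norm_le_l1_cart[of "\<alpha> - (\<chi> i. real_of_int (p i) / P)"] by simp
  also have "\<dots> \<le> (\<Sum>i\<in>(UNIV :: 'n set). 1 / P)"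
  proof (intro sum_mono)
    fix i
    have "\<bar>P * \<alpha> $ i - real_of_int (p i)\<bar> \<le> 1"
      unfolding p_def by linarith
    moreover have "\<alpha> $ i - real_of_int (p i) / P = (P * \<alpha> $ i - real_of_int (p i)) / P"
      using P by (simp add: field_simps)
    ultimately show "\<bar>\<alpha> $ i - real_of_int (p i) / P\<bar> \<le> 1 / P"
      using P by (simp add: abs_divide divide_right_mono)
  qed
  also have "\<dots> \<le> \<eta>"
  proof -
    have "real CARD('n) / \<eta> \<le> P"
      by (simp add: P_def)
    then show ?thesis
      using assms P by (simp add: field_simps)
  qed
  finally show "norm (\<alpha> - (\<chi> i. real_of_int (p i) / P)) \<le> \<eta>" .
qed

lemma norm_le_of_components:
  fixes x :: "real ^ 'n::finite"
  assumes "\<And>i. \<bar>x $ i\<bar> \<le> b"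
  shows "norm x \<le> sqrt (real CARD('n)) * b"
proof -
  have "0 \<le> b"
    using assms[of undefined] by linarith
  have "(norm x)\<^sup>2 = (\<Sum>i\<in>UNIV. (x $ i)\<^sup>2)"
    by (simp add: norm_vec_def L2_set_def sum_nonneg)
  also have "\<dots> \<le> (\<Sum>i\<in>(UNIV :: 'n set). b\<^sup>2)"
    using assms by (intro sum_mono) (simp add: abs_le_square_iff[symmetric] \<open>0 \<le> b\<close>)
  also have "\<dots> = (sqrt (real CARD('n)) * b)\<^sup>2"
    by (simp add: power_mult_distrib)
  finally show ?thesis
    by (rule power2_le_imp_le) (simp add: \<open>0 \<le> b\<close>)
qed

section \<open>Filling time from a spectral gap\<close>

text \<open>On a time interval of length \<open>8 / \<epsilon>\<close> the flow is within \<open>\<delta> / 2\<close> of a periodic one, of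
  period \<open>P\<close> and direction \<open>p / P\<close>, which inherits the gap \<open>\<epsilon> / 2\<close>.\<close>

lemma fills_torus_of_gap:
  fixes \<alpha> :: "real ^ 'n::finite"
  assumes "0 < \<epsilon>" "0 < \<delta>" "\<delta> < 1 / 2" and N: "4 * real CARD('n) \<le> N * \<delta>"
    and gap: "\<And>k. k \<in> int_lattice \<Longrightarrow> 0 < norm k \<Longrightarrow> norm k \<le> N \<Longrightarrow> \<epsilon> \<le> \<bar>k \<bullet> \<alpha>\<bar>"
  shows "fills_torus \<alpha> \<delta> (8 / \<epsilon>)"
proof (rule fills_torusI)
  fix \<theta> c :: "real ^ 'n"
  define n where "n = real CARD('n)"
  have n: "1 \<le> n"
    by (simp add: n_def Suc_le_eq)
  have "0 < N * \<delta>"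
    using N n unfolding n_def by linarith
  then have "0 < N"
    using \<open>0 < \<delta>\<close> by (simp add: zero_less_mult_iff)
  define T where "T = 8 / \<epsilon>"
  have T: "0 < T"
    using \<open>0 < \<epsilon>\<close> by (simp add: T_def)
  \<comment> \<open>The first bound changes \<open>k \<bullet> \<alpha>\<close> by at most
    \<open>\<epsilon> / 2\<close> when \<open>norm k \<le> N\<close>; the second limits the drift to
    \<open>\<delta> / 2\<close> over times \<open>|t| \<le> T / 2\<close>.\<close>
  define \<eta> where "\<eta> = min (\<epsilon> / (2 * N)) (\<delta> / T)"
  have "0 < \<eta>"
    using \<open>0 < \<epsilon>\<close> \<open>0 < \<delta>\<close> \<open>0 < N\<close> T by (simp add: \<eta>_def)
  then obtain P p where P: "4 / \<epsilon> \<le> P" "0 < P"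
    and approx: "norm (\<alpha> - (\<chi> i. real_of_int (p i) / P)) \<le> \<eta>"
    using approx_by_fractions by blast
  define \<beta> :: "real ^ 'n" where "\<beta> = (\<chi> i. real_of_int (p i) / P)"
  have \<beta>: "norm (\<alpha> - \<beta>) \<le> \<epsilon> / (2 * N)" "norm (\<alpha> - \<beta>) \<le> \<delta> / T"
    using approx by (auto simp: \<beta>_def \<eta>_def)
  \<comment> \<open>The largest integer strictly below \<open>P * \<epsilon> / 2\<close>, which will
    bound \<open>|k . p|\<close> from below; \<open>4 / \<epsilon> \<le> P\<close> makes it at least
    1.\<close>
  define L where "L = nat \<lceil>P * \<epsilon> / 2\<rceil> - 1"
  have P\<epsilon>: "2 \<le> P * \<epsilon> / 2"
    using P \<open>0 < \<epsilon>\<close> by (simp add: field_simps)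
  then have L: "1 \<le> L" "real L < P * \<epsilon> / 2" "P * \<epsilon> / 2 \<le> real (L + 1)"
    unfolding L_def by linarith+
  \<comment> \<open>Integer vectors with entries up to \<open>m\<close> have norm at most
    \<open>sqrt n * m \<le> N\<close>, the range of the gap.\<close>
  define m where "m = nat \<lfloor>N / sqrt n\<rfloor>"
  have "sqrt n \<le> n"
    using n by (simp add: sqrt_le_D real_le_lsqrt power2_eq_square)
  also have "n \<le> N"
  proof -
    have "N * \<delta> \<le> N * 1"
      using \<open>0 < N\<close> \<open>\<delta> < 1 / 2\<close> by (intro mult_left_mono) auto
    then show ?thesis using N n unfolding n_def by linarith
  qed
  finally have "1 \<le> N / sqrt n"
    using n by simp
  then have m: "1 \<le> m" "real m \<le> N / sqrt n" "N / sqrt n \<le> real (m + 1)"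
    unfolding m_def by linarith+
  \<comment> \<open>Position relative to the target at the middle of the time interval: the time
    offset found below can have either sign.\<close>
  define x where "x i = (\<theta> + (T / 2) *\<^sub>R \<alpha> - c) $ i" for i
  \<comment> \<open>By \<open>sin_squared_bound\<close> the true offsets are half these tolerances:
    below \<open>T / (2 * P)\<close> in rescaled time, thus \<open>T / 2\<close> in real time, and
    below \<open>\<delta> / 2\<close> in space.\<close>
  obtain u where u: "(sin (pi * u))\<^sup>2 / (T / P)\<^sup>2
      + (\<Sum>i\<in>UNIV. (sin (pi * (x i + u * real_of_int (p i))))\<^sup>2) / \<delta>\<^sup>2 < 1"
  proof (rule rational_line_meets_origin[OF L(1) m(1)])
    show "0 < (T / P)\<^sup>2" "0 < \<delta>\<^sup>2"
      using T P \<open>0 < \<delta>\<close> by simp_all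
    show "int L < \<bar>\<Sum>i\<in>UNIV. k i * p i\<bar>" if "k \<noteq> (\<lambda>_. 0)" and k: "\<forall>i. \<bar>k i\<bar> \<le> int m" for k
    proof -
      define \<kappa> :: "real ^ 'n" where "\<kappa> = (\<chi> i. real_of_int (k i))"
      have "\<kappa> \<in> int_lattice"
        by (simp add: \<kappa>_def int_lattice_def)
      have "\<kappa> \<noteq> 0"
        using that(1) by (auto simp: \<kappa>_def vec_eq_iff)
      have "\<bar>\<kappa> $ i\<bar> \<le> real m" for i
        using k[rule_format, of i] by (simp add: \<kappa>_def flip: of_int_abs)
      then have "norm \<kappa> \<le> sqrt n * real m"
        unfolding n_def by (rule norm_le_of_components)
      also have "\<dots> \<le> N"
        using m(2) n by (simp add: field_simps)
      finally have "norm \<kappa> \<le> N" .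
      then have "\<epsilon> \<le> \<bar>\<kappa> \<bullet> \<alpha>\<bar>"
        using gap \<open>\<kappa> \<in> int_lattice\<close> \<open>\<kappa> \<noteq> 0\<close> by simp
      moreover have "\<bar>\<kappa> \<bullet> (\<alpha> - \<beta>)\<bar> \<le> \<epsilon> / 2"
      proof -
        have "\<bar>\<kappa> \<bullet> (\<alpha> - \<beta>)\<bar> \<le> norm \<kappa> * norm (\<alpha> - \<beta>)"
          by (rule Cauchy_Schwarz_ineq2)
        also have "\<dots> \<le> N * (\<epsilon> / (2 * N))"
          using \<beta>(1) \<open>norm \<kappa> \<le> N\<close> \<open>0 < N\<close> by (intro mult_mono) auto
        finally show ?thesis using \<open>0 < N\<close> by simp
      qed
      ultimately have "\<epsilon> / 2 \<le> \<bar>\<kappa> \<bullet> \<beta>\<bar>"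
        unfolding inner_diff_right by linarith
      then have "P * (\<epsilon> / 2) \<le> P * \<bar>\<kappa> \<bullet> \<beta>\<bar>"
        using P by (intro mult_left_mono) auto
      also have "\<dots> = \<bar>P * (\<kappa> \<bullet> \<beta>)\<bar>"
        using P by (simp add: abs_mult)
      also have "P * (\<kappa> \<bullet> \<beta>) = real_of_int (\<Sum>i\<in>UNIV. k i * p i)"
        using P by (simp add: inner_vec_def \<kappa>_def \<beta>_def sum_distrib_left)
      finally have "real L < real_of_int \<bar>\<Sum>i\<in>UNIV. k i * p i\<bar>"
        using L(2) by simp
      then show ?thesis by linarith
    qed
    \<comment> \<open>Origin of the 8: with \<open>pi < 4\<close> the kernel width is at most
      \<open>4 / (P * \<epsilon>)\<close>, and \<open>T = 8 / \<epsilon>\<close> makes this half of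
      \<open>T / P\<close>.\<close>
    have "(pi / (2 * real (L + 1)))\<^sup>2 / (T / P)\<^sup>2 \<le> 1 / 4"
    proof -
      have "pi / (2 * real (L + 1)) \<le> 4 / (2 * (P * \<epsilon> / 2))"
        using pi_less_4 L(3) P\<epsilon> by (intro frac_le) auto
      also have "\<dots> = (T / P) / 2"
        using P \<open>0 < \<epsilon>\<close> by (simp add: T_def field_simps)
      finally have "(pi / (2 * real (L + 1)))\<^sup>2 \<le> ((T / P) / 2)\<^sup>2"
        by (intro power_mono) auto
      then have "(pi / (2 * real (L + 1)))\<^sup>2 / (T / P)\<^sup>2 \<le> ((T / P) / 2)\<^sup>2 / (T / P)\<^sup>2"
        by (intro divide_right_mono) auto
      also have "\<dots> = 1 / 4"
        using T P by (simp add: power_divide)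
      finally show ?thesis .
    qed
    \<comment> \<open>Here \<open>4 * n \<le> N * \<delta>\<close> enters: the width is at most
      \<open>2 * sqrt n / N\<close>, so the \<open>n\<close> coordinates together contribute at most
      the square of \<open>2 * n / (N * \<delta>)\<close>.\<close>
    moreover have "n * (pi / (2 * real (m + 1)))\<^sup>2 / \<delta>\<^sup>2 \<le> 1 / 4"
    proof -
      have "pi / (2 * real (m + 1)) \<le> 4 / (2 * (N / sqrt n))"
        using pi_less_4 m(3) n \<open>0 < N\<close> by (intro frac_le) auto
      then have "(pi / (2 * real (m + 1)))\<^sup>2 \<le> (4 / (2 * (N / sqrt n)))\<^sup>2"
        by (intro power_mono) auto
      also have "\<dots> = 4 * n / N\<^sup>2"
        using n by (simp add: power_divide power_mult_distrib)
      finally have "n * (pi / (2 * real (m + 1)))\<^sup>2 / \<delta>\<^sup>2 \<le> n * (4 * n / N\<^sup>2) / \<delta>\<^sup>2"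
        using n by (intro divide_right_mono mult_left_mono) auto
      also have "\<dots> = (2 * n / (N * \<delta>))\<^sup>2"
        by (simp add: power_divide power_mult_distrib power2_eq_square mult_ac)
      also have "\<dots> \<le> (1 / 2)\<^sup>2"
        using N \<open>0 < N * \<delta>\<close> n by (intro power_mono) (auto simp: n_def divide_simps)
      finally show ?thesis by (simp add: power2_eq_square)
    qed
    ultimately show "(pi / (2 * real (L + 1)))\<^sup>2 / (T / P)\<^sup>2
      + real CARD('n) * (pi / (2 * real (m + 1)))\<^sup>2 / \<delta>\<^sup>2 < 1"
      unfolding n_def by linarith
  qed
  define v where "v = u - of_int (round u)"
  define t where "t = v * P"
  have sums: "0 \<le> (\<Sum>i\<in>UNIV. (sin (pi * (x i + u * real_of_int (p i))))\<^sup>2)"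
    by (simp add: sum_nonneg)
  have "(sin (pi * u))\<^sup>2 / (T / P)\<^sup>2 < 1"
    using u divide_nonneg_nonneg[OF sums zero_le_power2[of \<delta>]] by linarith
  then have "(sin (pi * u))\<^sup>2 < (T / P)\<^sup>2"
    using T P by (simp add: divide_less_eq_1)
  then have "(2 * v)\<^sup>2 < (T / P)\<^sup>2"
    using sin_squared_bound[of u] by (simp add: power_mult_distrib flip: v_def)
  then have "\<bar>2 * v\<bar> < T / P"
    using T P power2_less_imp_less[of "\<bar>2 * v\<bar>" "T / P"]
    by (simp only: power2_abs divide_pos_pos less_imp_le)
  then have t: "\<bar>t\<bar> \<le> T / 2"
    using P by (simp add: t_def abs_mult field_simps)
  \<comment> \<open>The lattice point nearest to \<open>x + u p\<close>, corrected for the dropped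
    periods; \<open>y\<close> then has exactly the offsets from the nearest integers as
    components.\<close>
  define k :: "real ^ 'n"
    where "k = (\<chi> i. of_int (round (x i + u * real_of_int (p i)) - round u * p i))"
  define y where "y = \<theta> + (T / 2) *\<^sub>R \<alpha> - c + t *\<^sub>R \<beta> - k"
  have y: "y $ i = x i + u * real_of_int (p i) - of_int (round (x i + u * real_of_int (p i)))" for i
    using P by (simp add: y_def x_def \<beta>_def k_def t_def v_def algebra_simps)
  have "(\<Sum>i\<in>UNIV. (sin (pi * (x i + u * real_of_int (p i))))\<^sup>2) / \<delta>\<^sup>2 < 1"
    using u divide_nonneg_nonneg[OF zero_le_power2[of "sin (pi * u)"] zero_le_power2[of "T / P"]]
    by linarith
  then have "(\<Sum>i\<in>UNIV. (sin (pi * (x i + u * real_of_int (p i))))\<^sup>2) < \<delta>\<^sup>2"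
    using \<open>0 < \<delta>\<close> by (simp add: divide_less_eq_1)
  moreover have "4 * (norm y)\<^sup>2 \<le> (\<Sum>i\<in>UNIV. (sin (pi * (x i + u * real_of_int (p i))))\<^sup>2)"
  proof -
    have "4 * (norm y)\<^sup>2 = (\<Sum>i\<in>UNIV. 4 * (y $ i)\<^sup>2)"
      by (simp add: norm_vec_def L2_set_def sum_nonneg sum_distrib_left)
    also have "\<dots> \<le> (\<Sum>i\<in>UNIV. (sin (pi * (x i + u * real_of_int (p i))))\<^sup>2)"
      unfolding y by (intro sum_mono sin_squared_bound)
    finally show ?thesis .
  qed
  ultimately have "(2 * norm y)\<^sup>2 \<le> \<delta>\<^sup>2"
    by (simp add: power_mult_distrib)
  then have norm_y: "norm y \<le> \<delta> / 2"
    using \<open>0 < \<delta>\<close> power2_le_imp_le[of "2 * norm y" \<delta>] by simp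
  show "\<exists>t\<in>{0..8 / \<epsilon>}. \<exists>k\<in>int_lattice. norm (c - (\<theta> + t *\<^sub>R \<alpha>) - k) \<le> \<delta>"
  proof (intro bexI)
    \<comment> \<open>The periodic orbit misses the target by at most \<open>\<delta> / 2\<close>;
      returning from \<open>\<beta>\<close> to \<open>\<alpha>\<close> costs the other half.\<close>
    have "c - (\<theta> + (T / 2 + t) *\<^sub>R \<alpha>) - (- k) = - (y + t *\<^sub>R (\<alpha> - \<beta>))"
      by (simp add: y_def algebra_simps)
    then have "norm (c - (\<theta> + (T / 2 + t) *\<^sub>R \<alpha>) - (- k)) = norm (y + t *\<^sub>R (\<alpha> - \<beta>))"
      by (simp only: norm_minus_cancel)
    also have "\<dots> \<le> norm y + \<bar>t\<bar> * norm (\<alpha> - \<beta>)"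
      using norm_triangle_ineq[of y "t *\<^sub>R (\<alpha> - \<beta>)"] by simp
    also have "\<dots> \<le> \<delta> / 2 + (T / 2) * (\<delta> / T)"
      using norm_y t \<beta>(2) T by (intro add_mono mult_mono) auto
    also have "\<dots> = \<delta>"
      using T by simp
    finally show "norm (c - (\<theta> + (T / 2 + t) *\<^sub>R \<alpha>) - (- k)) \<le> \<delta>" .
    show "- k \<in> int_lattice"
      by (rule int_lattice_minus) (simp add: k_def int_lattice_def)
    show "T / 2 + t \<in> {0..8 / \<epsilon>}"
      using t unfolding T_def[symmetric] by auto
  qed
qed

section \<open>Derivation of the explicit constant\<close>

theorem theorem1:
  fixes \<tau> \<gamma> \<delta> N :: real and \<alpha> :: "real ^ 'n::finite"
  assumes "CARD('n) \<ge> 2"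
    and "\<tau> > real CARD('n) - 1"
    and "0 < \<gamma>" and "\<gamma> < 1"
    and "(diophantine_dir \<tau> \<gamma> :: (real ^ 'n) set) \<noteq> {}"
    and "0 < \<delta>" and "\<delta> < 1 / 2"
    and "N = (1 + real CARD('n) ^ 2 * fact CARD('n)) / \<delta>"
    and "\<alpha> \<in> diophantine_dir_upto \<tau> \<gamma> N"
  shows "\<exists>T. 0 \<le> T \<and> T < fill_const CARD('n) \<tau> / (\<gamma> * \<delta> powr \<tau>) \<and> fills_torus \<alpha> \<delta> T"
proof -
  define n where "n = real CARD('n)"
  define C where "C = 1 + n ^ 2 * fact CARD('n)"
  \<comment> \<open>The Diophantine bound decreases in \<open>norm k\<close>, so its value at
    \<open>N\<close> is a uniform gap.\<close>
  define \<epsilon> where "\<epsilon> = \<gamma> * N powr (- \<tau>)"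
  have n: "2 \<le> n" and "0 < \<tau>"
    using assms(1,2) by (simp_all add: n_def)
  have "(fact 2 :: real) \<le> fact CARD('n)"
    using assms(1) by (intro fact_mono)
  then have "n ^ 2 * 2 \<le> n ^ 2 * fact CARD('n)"
    by (intro mult_left_mono) (simp_all add: fact_numeral)
  moreover have "2 * n \<le> n ^ 2"
    using n by (simp add: power2_eq_square)
  \<comment> \<open>Serves twice: \<open>4 * n \<le> C = N * \<delta>\<close> is what the gap lemma
    asks for, and \<open>n \<ge> 2\<close> gives \<open>C \<ge> 9\<close>, so the factor 8 in the
    filling time is absorbed into one extra power of \<open>C\<close>.\<close>
  ultimately have C: "4 * n + 1 \<le> C"
    by (simp add: C_def)
  have N: "N = C / \<delta>"
    by (simp add: assms(8) C_def n_def)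
  have "0 < N"
    using C n \<open>0 < \<delta>\<close> by (simp add: N)
  have "0 < \<epsilon>"
    using \<open>0 < \<gamma>\<close> \<open>0 < N\<close> by (simp add: \<epsilon>_def)
  have gap: "\<epsilon> \<le> \<bar>k \<bullet> \<alpha>\<bar>" if "k \<in> int_lattice" "0 < norm k" "norm k \<le> N" for k :: "real ^ 'n"
  proof -
    have "N powr (- \<tau>) \<le> norm k powr (- \<tau>)"
      using that \<open>0 < \<tau>\<close> by (intro powr_mono2') auto
    then have "\<epsilon> \<le> \<gamma> * norm k powr (- \<tau>)"
      using \<open>0 < \<gamma>\<close> by (simp add: \<epsilon>_def)
    also have "\<dots> \<le> \<bar>k \<bullet> \<alpha>\<bar>"
      using that assms(9) by (simp add: diophantine_dir_upto_def diophantine_upto_def)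
    finally show ?thesis .
  qed
  have "8 / \<epsilon> = 8 * C powr \<tau> / (\<gamma> * \<delta> powr \<tau>)"
    using C n \<open>0 < \<delta>\<close> by (simp add: \<epsilon>_def N powr_divide powr_minus field_simps)
  also have "\<dots> < C * C powr \<tau> / (\<gamma> * \<delta> powr \<tau>)"
    using C n \<open>0 < \<delta>\<close> \<open>0 < \<gamma>\<close> by (intro divide_strict_right_mono mult_strict_right_mono) auto
  also have "C * C powr \<tau> = fill_const CARD('n) \<tau>"
    using C n by (simp add: fill_const_def powr_add flip: C_def n_def)
  finally have "8 / \<epsilon> < fill_const CARD('n) \<tau> / (\<gamma> * \<delta> powr \<tau>)" .
  moreover have "fills_torus \<alpha> \<delta> (8 / \<epsilon>)"
    using C N \<open>0 < \<epsilon>\<close> assms(6,7) gap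
    by (intro fills_torus_of_gap[where N = N]) (auto simp: n_def)
  moreover have "0 \<le> 8 / \<epsilon>"
    using \<open>0 < \<epsilon>\<close> by simp
  ultimately show ?thesis by blast
qed

end
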